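(* Each diameter diminishing to zero iterated function system $\mathcal{S}=((X,d),(f_i)_{i\in I})$ has an attractor $A_{\mathcal{S}}$, and $$A_{\mathcal{S}}=\pi(\Lambda(I))=\{a_\omega\mid\omega\in\Lambda(I)\}.$$
   Context: Metric spaces are nonempty. For a metric space $(X,d)$, $P_b(X)$ is the set of nonempty bounded subsets of $X$, $P_{b,cl}(X)$ the set of nonempty bounded closed subsets, and $H_d$ the Hausdorff-Pompeiu metric on $P_{b,cl}(X)$, $H_d(A,B)=\max\{\sup_{x\in A}d(x,B),\sup_{x\in B}d(x,A)\}$, where $d(x,A)=\inf_{y\in A}d(x,y)$. An iterated function system (IFS) is a pair $\mathcal{S}=((X,d),(f_i)_{i\in I})$ where $(X,d)$ is a complete metric space, $I$ is a nonempty finite set, each $f_i:X\to X$ is continuous, and $f_i(B)\in P_b(X)$ for every $B\in P_b(X)$ and $i\in I$. Its fractal operator $F_{\mathcal{S}}:P_{b,cl}(X)\to P_{b,cl}(X)$ is $F_{\mathcal{S}}(B)=\overline{\bigcup_{i\in I}f_i(B)}$; $F_{\mathcal{S}}^{[n]}$ is its $n$-fold composition. $\mathbb{N}^*=\{1,2,\dots\}$. $\Lambda(I)=I^{\mathbb{N}^*}$ is the set of infinite words $\omega=\omega_1\omega_2\dots$ over $I$; $\Lambda_n(I)$ is the set of words of length $n$ over $I$; $[\omega]_n=\omega_1\dots\omega_n$ for $\omega\in\Lambda(I)$; $f_\omega=f_{\omega_1}\circ\dots\circ f_{\omega_n}$ for $\omega=\omega_1\dots\omega_n\in\Lambda_n(I)$.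 An IFS $\mathcal{S}$ is diameter diminishing to zero if for every $B\in P_{b,cl}(X)$ there exists $M_B\in P_{b,cl}(X)$ such that $B\subseteq M_B$, $F_{\mathcal{S}}(M_B)\subseteq M_B$ and $\lim_{n\to\infty}\max_{\omega\in\Lambda_n(I)}\mathrm{diam}(f_\omega(M_B))=0$. For a diameter diminishing to zero IFS and $\omega\in\Lambda(I)$, $a_\omega\in X$ denotes the unique point (it exists) such that $\bigcap_{n\in\mathbb{N}^*}\overline{f_{[\omega]_n}(B)}=\{a_\omega\}$ for every $B\in P_{b,cl}(X)$ with $F_{\mathcal{S}}(B)\subseteq B$; and $\pi:\Lambda(I)\to X$ is defined by $\pi(\omega)=a_\omega$. An IFS $\mathcal{S}$ has an attractor if there exists $A_{\mathcal{S}}\in P_{b,cl}(X)$ with $F_{\mathcal{S}}(A_{\mathcal{S}})=A_{\mathcal{S}}$ and $\lim_{n\to\infty}H_d(F_{\mathcal{S}}^{[n]}(B),A_{\mathcal{S}})=0$ for each $B\in P_{b,cl}(X)$; $A_{\mathcal{S}}$ (which is unique) is called the attractor of $\mathcal{S}$. *)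

theory Defs
  imports "HOL-Analysis.Analysis" "HOL-Library.Stream"
begin

text \<open>
  A metric space is a type of class \<open>metric_space\<close> (types are nonempty); an IFS is a
  finite index set \<open>I\<close> together with maps \<open>f i\<close>, of which only those with \<open>i \<in> I\<close> matter.
\<close>

definition Pb :: "'a::metric_space set set" where
  "Pb = {B. B \<noteq> {} \<and> bounded B}"

definition Pbcl :: "'a::metric_space set set" where
  "Pbcl = {B. B \<noteq> {} \<and> bounded B \<and> closed B}"

definition hausdorff_dist :: "'a::metric_space set \<Rightarrow> 'a set \<Rightarrow> real" where
  "hausdorff_dist A B = max (SUP x\<in>A. infdist x B) (SUP x\<in>B. infdist x A)"

definition is_IFS :: "'i set \<Rightarrow> ('i \<Rightarrow> 'a::complete_space \<Rightarrow> 'a) \<Rightarrow> bool" where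
  "is_IFS I f \<longleftrightarrow> finite I \<and> I \<noteq> {} \<and>
     (\<forall>i\<in>I. continuous_on UNIV (f i) \<and> (\<forall>B\<in>Pb. f i ` B \<in> Pb))"

definition fractal_op :: "'i set \<Rightarrow> ('i \<Rightarrow> 'a::metric_space \<Rightarrow> 'a) \<Rightarrow> 'a set \<Rightarrow> 'a set" where
  "fractal_op I f B = closure (\<Union>i\<in>I. f i ` B)"

text \<open>
  Infinite words over \<open>I\<close> are the elements of \<open>streams I\<close>, and the prefix of length \<open>n\<close> of
  \<open>\<omega>\<close> is \<open>stake n \<omega>\<close>.
\<close>

definition words :: "'i set \<Rightarrow> nat \<Rightarrow> 'i list set" where
  "words I n = {w. set w \<subseteq> I \<and> length w = n}"

text \<open>The first letter of the word is the outermost map.\<close>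

definition word_map :: "('i \<Rightarrow> 'a \<Rightarrow> 'a) \<Rightarrow> 'i list \<Rightarrow> 'a \<Rightarrow> 'a" where
  "word_map f w = foldr (\<circ>) (map f w) id"

definition diam_diminishing :: "'i set \<Rightarrow> ('i \<Rightarrow> 'a::metric_space \<Rightarrow> 'a) \<Rightarrow> bool" where
  "diam_diminishing I f \<longleftrightarrow>
     (\<forall>B\<in>Pbcl. \<exists>M\<in>Pbcl. B \<subseteq> M \<and> fractal_op I f M \<subseteq> M \<and>
        (\<lambda>n. MAX w\<in>words I n. diameter (word_map f w ` M)) \<longlonglongrightarrow> 0)"

definition code_point :: "'i set \<Rightarrow> ('i \<Rightarrow> 'a::metric_space \<Rightarrow> 'a) \<Rightarrow> 'i stream \<Rightarrow> 'a" where
  "code_point I f \<omega> =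
     (THE a. \<forall>B\<in>Pbcl. fractal_op I f B \<subseteq> B \<longrightarrow>
        (\<Inter>n\<in>{1..}. closure (word_map f (stake n \<omega>) ` B)) = {a})"

definition canonical_proj :: "'i set \<Rightarrow> ('i \<Rightarrow> 'a::metric_space \<Rightarrow> 'a) \<Rightarrow> 'i stream \<Rightarrow> 'a" where
  "canonical_proj I f = (\<lambda>\<omega>. code_point I f \<omega>)"

definition is_attractor :: "'i set \<Rightarrow> ('i \<Rightarrow> 'a::metric_space \<Rightarrow> 'a) \<Rightarrow> 'a set \<Rightarrow> bool" where
  "is_attractor I f A \<longleftrightarrow> A \<in> Pbcl \<and> fractal_op I f A = A \<and>
     (\<forall>B\<in>Pbcl. (\<lambda>n. hausdorff_dist ((fractal_op I f ^^ n) B) A) \<longlonglongrightarrow> 0)"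

definition has_attractor :: "'i set \<Rightarrow> ('i \<Rightarrow> 'a::metric_space \<Rightarrow> 'a) \<Rightarrow> bool" where
  "has_attractor I f \<longleftrightarrow> (\<exists>A. is_attractor I f A)"

definition attractor :: "'i set \<Rightarrow> ('i \<Rightarrow> 'a::metric_space \<Rightarrow> 'a) \<Rightarrow> 'a set" where
  "attractor I f = (THE A. is_attractor I f A)"

end

theory Submission
  imports Defs
begin

text \<open>
  Fix a diameter diminishing IFS. If \<open>M\<close> is bounded, closed and mapped into itself by the fractal
  operator, then along an infinite word \<open>\<omega>\<close> the sets \<open>closure (f\<^sub>w(M))\<close>, \<open>w\<close> a prefix of
  \<open>\<omega>\<close>, decrease and their diameters tend to \<open>0\<close>; by completeness they meet in one point. Any two
  invariant sets lie in a common one of the kind that the hypothesis supplies, so this point does not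
  depend on \<open>M\<close>: it is the code point \<open>a\<^sub>\<omega>\<close> (lemma \<open>code_point_props\<close>).

  Let \<open>A\<close> be the set of all code points. Continuity gives \<open>f\<^sub>i(a\<^sub>\<omega>) = a\<^sub>i\<^sub>\<omega>\<close>, so
  \<open>A\<close> is the union of the images \<open>f\<^sub>i(A)\<close> and, iterating, of the images \<open>f\<^sub>w(A)\<close> over
  the words \<open>w\<close> of length \<open>n\<close>. This self-similarity also makes \<open>A\<close> closed (lemma
  \<open>closed_code_points\<close>): a point of its closure lies in the closure of some \<open>f\<^sub>i(A)\<close>, as there are only
  finitely many of them; repeating this inside \<open>f\<^sub>i(A)\<close> spells out an infinite word whose code
  point is the given point. Hence \<open>A\<close> is a fixed point of the fractal operator.

  For convergence, put \<open>A\<close> and the starting set \<open>B\<close> into one set \<open>M\<close> with diminishing images.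
  Up to closure the \<open>n\<close>-th iterate of \<open>B\<close> is the union of the \<open>f\<^sub>w(B)\<close>, while \<open>A\<close> is the union
  of the \<open>f\<^sub>w(A)\<close>; as \<open>f\<^sub>w(B)\<close> and \<open>f\<^sub>w(A)\<close> both lie in \<open>f\<^sub>w(M)\<close>, the Hausdorff distance
  is at most the largest diameter of the sets \<open>f\<^sub>w(M)\<close>. Uniqueness of the attractor holds because a second
  one is itself a constant sequence of iterates.
\<close>

section \<open>Words and closures of unions\<close>

lemma word_map_Nil [simp]: "word_map f [] = id"
  by (simp add: word_map_def)

lemma word_map_Cons [simp]: "word_map f (i # w) = f i \<circ> word_map f w"
  by (simp add: word_map_def)

lemma word_map_append: "word_map f (u @ v) = word_map f u \<circ> word_map f v"
  by (induction u) auto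

lemma words_Suc: "words I (Suc n) = (\<Union>i\<in>I. (#) i ` words I n)"
  by (auto simp: words_def length_Suc_conv)

lemma words_0 [simp]: "words I 0 = {[]}"
  by (auto simp: words_def)

lemma words_nonempty:
  assumes "I \<noteq> {}"
  shows "words I n \<noteq> {}"
proof -
  from assms obtain i where "i \<in> I" by blast
  then have "replicate n i \<in> words I n" by (auto simp: words_def)
  then show ?thesis by blast
qed

lemma finite_words: "finite I \<Longrightarrow> finite (words I n)"
  unfolding words_def by (rule finite_lists_length_eq)

lemma stake_in_words: "\<omega> \<in> streams I \<Longrightarrow> stake n \<omega> \<in> words I n"
  by (auto simp: words_def in_set_conv_nth streams_iff_snth)

text \<open>Dependent choice, phrased for words: the infinite word collects the letters chosen at each
  prefix.\<close>

lemma stream_of_extendable_prefixes: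
  assumes Nil: "P []" and ext: "\<And>w. P w \<Longrightarrow> \<exists>i\<in>I. P (w @ [i])"
  obtains \<omega> where "\<omega> \<in> streams I" "\<And>n. P (stake n \<omega>)"
proof -
  from ext obtain g where g: "\<And>w. P w \<Longrightarrow> g w \<in> I \<and> P (w @ [g w])" by metis
  define h where "h = rec_nat [] (\<lambda>_ w. w @ [g w])"
  have h: "h 0 = []" "h (Suc n) = h n @ [g (h n)]" for n by (simp_all add: h_def)
  have P: "P (h n)" for n by (induction n) (use g Nil in \<open>auto simp: h\<close>)
  define \<omega> where "\<omega> = smap (\<lambda>n. g (h n)) nats"
  have "stake n \<omega> = h n" for n
    by (induction n) (simp_all add: h stake_Suc \<omega>_def del: stake.simps(2))
  moreover have "\<omega> \<in> streams I"
    using g P by (auto simp: streams_iff_snth \<omega>_def)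
  ultimately show thesis using that P by metis
qed

lemma closure_finite_UN:
  assumes "finite I"
  shows "closure (\<Union>i\<in>I. B i) = (\<Union>i\<in>I. closure (B i))"
  using assms by (induction rule: finite_induct) auto

lemma dist_closure_le:
  assumes "x \<in> closure S" "y \<in> closure S"
    and le: "\<And>u v. u \<in> S \<Longrightarrow> v \<in> S \<Longrightarrow> dist u v \<le> e"
  shows "dist x y \<le> e"
proof -
  have "dist u y \<le> e" if "u \<in> S" for u
    by (rule continuous_le_on_closure[OF _ assms(2)]) (use le that in \<open>auto intro: continuous_intros\<close>)
  then show ?thesis
    by (intro continuous_le_on_closure[OF _ assms(1), of "\<lambda>u. dist u y"])
      (auto intro: continuous_intros)
qed

text \<open>Iterating the union of the images, without taking closures, applies every word of length
  \<open>n\<close> once.\<close>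

lemma UN_words_Suc:
  "(\<Union>w\<in>words I (Suc n). word_map f w ` B) =
   (\<Union>i\<in>I. f i ` (\<Union>w\<in>words I n. word_map f w ` B))"
  by (auto simp: words_Suc image_iff)

lemma invariant_word_map:
  assumes "fractal_op I f M \<subseteq> M" "set w \<subseteq> I"
  shows "word_map f w ` M \<subseteq> M"
  using assms(2)
proof (induction w)
  case (Cons i w)
  have "f i ` M \<subseteq> M"
    using assms(1) Cons.prems closure_subset[of "\<Union>i\<in>I. f i ` M"]
    unfolding fractal_op_def by auto
  with Cons show ?case by (auto simp: image_comp[symmetric])
qed simp

section \<open>The Hausdorff distance\<close>

text \<open>The absolute value is needed for limits: a real supremum is known to be nonnegative only once
  its family is bounded above, and \<open>e\<close> supplies that bound too.\<close>

lemma abs_hausdorff_dist_le: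
  assumes "A \<noteq> {}" "B \<noteq> {}"
    and A: "\<And>x. x \<in> A \<Longrightarrow> infdist x B \<le> e"
    and B: "\<And>x. x \<in> B \<Longrightarrow> infdist x A \<le> e"
  shows "\<bar>hausdorff_dist A B\<bar> \<le> e"
proof -
  from assms(1) obtain a where a: "a \<in> A" by blast
  have "0 \<le> infdist a B" by (rule infdist_nonneg)
  also have "\<dots> \<le> (SUP x\<in>A. infdist x B)"
    by (rule cSUP_upper[OF a]) (use A in \<open>auto simp: bdd_above_def\<close>)
  finally have "0 \<le> (SUP x\<in>A. infdist x B)" .
  moreover have "(SUP x\<in>A. infdist x B) \<le> e" "(SUP x\<in>B. infdist x A) \<le> e"
    using assms by (auto intro!: cSUP_least)
  ultimately show ?thesis by (auto simp: hausdorff_dist_def)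
qed

lemma infdist_le_hausdorff_dist:
  assumes "bounded A" "bounded B" "B \<noteq> {}" "x \<in> A"
  shows "infdist x B \<le> hausdorff_dist A B"
proof -
  from assms obtain b where b: "b \<in> B" by blast
  obtain e where e: "\<And>y. y \<in> A \<Longrightarrow> dist b y \<le> e"
    using assms(1) bounded_any_center by blast
  have "infdist y B \<le> e" if "y \<in> A" for y
    using infdist_le[OF b, of y] e[OF that] by (simp add: dist_commute)
  then have "infdist x B \<le> (SUP x\<in>A. infdist x B)"
    by (intro cSUP_upper assms(4)) (auto simp: bdd_above_def)
  then show ?thesis by (simp add: hausdorff_dist_def)
qed

lemma hausdorff_dist_commute: "hausdorff_dist A B = hausdorff_dist B A"
  by (simp add: hausdorff_dist_def max.commute)

lemma hausdorff_dist_eq_0_imp_eq: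
  assumes "A \<in> Pbcl" "B \<in> Pbcl" "hausdorff_dist A B = 0"
  shows "A = B"
proof -
  have "C \<subseteq> D" if "C \<in> Pbcl" "D \<in> Pbcl" "hausdorff_dist C D = 0" for C D :: "'a set"
  proof
    fix x assume "x \<in> C"
    then have "infdist x D = 0"
      using infdist_le_hausdorff_dist[of C D x] that infdist_nonneg[of x D] by (auto simp: Pbcl_def)
    then show "x \<in> D"
      using that in_closed_iff_infdist_zero[of D x] by (auto simp: Pbcl_def)
  qed
  from this[OF assms] this[OF assms(2,1)] assms(3) show ?thesis
    by (auto simp: hausdorff_dist_commute)
qed

lemma infdist_closure_le:
  assumes "\<And>x. x \<in> C \<Longrightarrow> infdist x A \<le> e" "x \<in> closure C"
  shows "infdist x A \<le> e"
  using continuous_le_on_closure[OF _ assms(2,1)]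
  by (auto intro: continuous_intros)

text \<open>A fixed point equals all its iterates, so two attractors are at Hausdorff distance \<open>0\<close> from
  each other.\<close>

lemma is_attractor_unique:
  assumes "is_attractor I f A" "is_attractor I f A'"
  shows "A = A'"
proof -
  have "(fractal_op I f ^^ n) A = A" for n
    using assms(1) by (induction n) (auto simp: is_attractor_def)
  then have "(\<lambda>_::nat. hausdorff_dist A A') \<longlonglongrightarrow> 0"
    using assms by (auto simp: is_attractor_def)
  then have "hausdorff_dist A A' = 0" by (simp add: LIMSEQ_const_iff)
  then show ?thesis
    using assms hausdorff_dist_eq_0_imp_eq by (auto simp: is_attractor_def)
qed

section \<open>Code points\<close>

context
  fixes I :: "'i set" and f :: "'i \<Rightarrow> 'a::complete_space \<Rightarrow> 'a"
  assumes ifs: "is_IFS I f" and dim: "diam_diminishing I f"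
begin

lemma finite_I: "finite I" and I_nonempty: "I \<noteq> {}"
  and continuous_f: "i \<in> I \<Longrightarrow> continuous_on UNIV (f i)"
  using ifs by (auto simp: is_IFS_def)

lemma uniformly_small_word_images:
  assumes "B \<in> Pbcl"
  obtains M where "M \<in> Pbcl" "B \<subseteq> M" "fractal_op I f M \<subseteq> M"
    "\<And>e. e > 0 \<Longrightarrow> \<exists>N. \<forall>n\<ge>N. \<forall>w\<in>words I n. \<forall>x\<in>M. \<forall>y\<in>M.
        dist (word_map f w x) (word_map f w y) < e"
proof -
  from dim assms obtain M where M: "M \<in> Pbcl" "B \<subseteq> M" "fractal_op I f M \<subseteq> M"
    and lim: "(\<lambda>n. MAX w\<in>words I n. diameter (word_map f w ` M)) \<longlonglongrightarrow> 0"
    unfolding diam_diminishing_def by blast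
  show thesis
  proof (rule that[OF M])
    fix e :: real assume "e > 0"
    then have "\<forall>\<^sub>F n in sequentially. (MAX w\<in>words I n. diameter (word_map f w ` M)) < e"
      by (rule order_tendstoD(2)[OF lim])
    then obtain N where N: "\<And>n. n \<ge> N \<Longrightarrow> (MAX w\<in>words I n. diameter (word_map f w ` M)) < e"
      by (auto simp: eventually_sequentially)
    have "dist (word_map f w x) (word_map f w y) < e"
      if "n \<ge> N" "w \<in> words I n" "x \<in> M" "y \<in> M" for n w x y
    proof -
      have "word_map f w ` M \<subseteq> M"
        using that M(3) by (intro invariant_word_map) (auto simp: words_def)
      then have "bounded (word_map f w ` M)"
        using M(1) bounded_subset by (auto simp: Pbcl_def)
      then have "dist (word_map f w x) (word_map f w y) \<le> diameter (word_map f w ` M)"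
        using that by (intro diameter_bounded_bound) auto
      also have "\<dots> \<le> (MAX w\<in>words I n. diameter (word_map f w ` M))"
        using that finite_words[OF finite_I] by (intro Max_ge) auto
      finally show ?thesis using N[OF that(1)] by simp
    qed
    then show "\<exists>N. \<forall>n\<ge>N. \<forall>w\<in>words I n. \<forall>x\<in>M. \<forall>y\<in>M.
        dist (word_map f w x) (word_map f w y) < e" by blast
  qed
qed

lemma prefix_images_antimono:
  assumes "\<omega> \<in> streams I" "fractal_op I f M \<subseteq> M" "m \<le> n"
  shows "word_map f (stake n \<omega>) ` M \<subseteq> word_map f (stake m \<omega>) ` M"
proof -
  have split: "stake n \<omega> = stake m \<omega> @ stake (n - m) (sdrop m \<omega>)"
    using assms(3) by (simp add: stake_add)
  have "set (stake (n - m) (sdrop m \<omega>)) \<subseteq> I"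
    using assms(1) by (auto simp: in_set_conv_nth streams_iff_snth sdrop_snth)
  then show ?thesis
    using invariant_word_map[OF assms(2)]
    by (simp only: split word_map_append image_comp[symmetric] image_mono)
qed

text \<open>Cantor's intersection theorem. The diameters are controlled by a larger set supplied by the
  hypothesis, since \<open>M\<close> itself need not be that set.\<close>

lemma prefix_images_Inter_singleton:
  assumes "\<omega> \<in> streams I" "M \<in> Pbcl" "fractal_op I f M \<subseteq> M"
  shows "\<exists>a. (\<Inter>n\<in>{1..}. closure (word_map f (stake n \<omega>) ` M)) = {a}"
proof -
  let ?S = "\<lambda>n. closure (word_map f (stake n \<omega>) ` M)"
  obtain M' where M': "M \<subseteq> M'"
    and small: "\<And>e. e > 0 \<Longrightarrow> \<exists>N. \<forall>n\<ge>N. \<forall>w\<in>words I n. \<forall>x\<in>M'. \<forall>y\<in>M'.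
        dist (word_map f w x) (word_map f w y) < e"
    using uniformly_small_word_images[OF assms(2)] by metis
  have anti: "?S n \<subseteq> ?S m" if "m \<le> n" for m n
    using prefix_images_antimono[OF assms(1,3) that] by (rule closure_mono)
  have "\<exists>n. \<forall>x\<in>?S n. \<forall>y\<in>?S n. dist x y < e" if "e > 0" for e
  proof -
    obtain N where N: "\<And>w x y. w \<in> words I N \<Longrightarrow> x \<in> M' \<Longrightarrow> y \<in> M' \<Longrightarrow>
        dist (word_map f w x) (word_map f w y) < e / 2"
      using small[OF half_gt_zero[OF \<open>e > 0\<close>]] by blast
    \<comment> \<open>Passing to the closure turns the strict bound into a weak one, hence the half.\<close>
    have le: "dist u v \<le> e / 2"
      if "u \<in> word_map f (stake N \<omega>) ` M" "v \<in> word_map f (stake N \<omega>) ` M" for u v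
      using that N[OF stake_in_words[OF assms(1)]] M' by (force intro: less_imp_le)
    have "dist x y \<le> e / 2" if "x \<in> ?S N" "y \<in> ?S N" for x y
      using that by (rule dist_closure_le) (rule le)
    then show ?thesis using \<open>e > 0\<close> by (intro exI[of _ N]) force
  qed
  moreover have "?S n \<noteq> {}" for n using assms(2) by (simp add: Pbcl_def)
  ultimately obtain a where a: "\<Inter>(range ?S) = {a}"
    using decreasing_closed_nest_sing[of ?S] anti by (metis closed_closure)
  \<comment> \<open>The index \<open>0\<close> is harmless, because the sets decrease.\<close>
  have "(\<Inter>n\<in>{1..}. ?S n) = \<Inter>(range ?S)"
  proof (intro antisym INT_greatest)
    show "(\<Inter>n\<in>{1..}. ?S n) \<subseteq> ?S n" for n
      using anti[of n "Suc n"] INT_lower[of "Suc n" "{1..}" ?S] by force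
  qed blast
  with a show ?thesis by blast
qed

lemma exists_invariant:
  assumes "B \<in> Pbcl"
  obtains M where "M \<in> Pbcl" "B \<subseteq> M" "fractal_op I f M \<subseteq> M"
  by (rule uniformly_small_word_images[OF assms]) (rule that)

lemma Pbcl_Un: "B \<in> Pbcl \<Longrightarrow> C \<in> Pbcl \<Longrightarrow> B \<union> C \<in> Pbcl"
  by (auto simp: Pbcl_def)

text \<open>Any two invariant sets lie in a third one, whose singleton intersection contains both of
  theirs; so all invariant sets single out the same point, as the description of \<open>code_point\<close>
  requires.\<close>

lemma code_point_props:
  assumes "\<omega> \<in> streams I" "M \<in> Pbcl" "fractal_op I f M \<subseteq> M"
  shows "(\<Inter>n\<in>{1..}. closure (word_map f (stake n \<omega>) ` M)) = {code_point I f \<omega>}"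
proof -
  let ?T = "\<lambda>B. \<Inter>n\<in>{1..}. closure (word_map f (stake n \<omega>) ` B)"
  have mono: "?T B \<subseteq> ?T C" if "B \<subseteq> C" for B C
    using that by (intro INT_anti_mono closure_mono image_mono) auto
  obtain a where a: "?T M = {a}"
    using prefix_images_Inter_singleton[OF assms] by blast
  have all: "?T B = {a}" if B: "B \<in> Pbcl" "fractal_op I f B \<subseteq> B" for B
  proof -
    obtain b where b: "?T B = {b}"
      using prefix_images_Inter_singleton[OF assms(1) B] by blast
    obtain C where C: "C \<in> Pbcl" "M \<union> B \<subseteq> C" "fractal_op I f C \<subseteq> C"
      using exists_invariant[OF Pbcl_Un[OF assms(2) B(1)]] by blast
    obtain c where c: "?T C = {c}"
      using prefix_images_Inter_singleton[OF assms(1) C(1,3)] by blast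
    have "a = c" "b = c" using mono[of M C] mono[of B C] C(2) a b c by auto
    with b show ?thesis by simp
  qed
  have "code_point I f \<omega> = a"
    unfolding code_point_def
  proof (rule the_equality)
    show "\<forall>B\<in>Pbcl. fractal_op I f B \<subseteq> B \<longrightarrow> ?T B = {a}" using all by blast
  next
    fix b assume "\<forall>B\<in>Pbcl. fractal_op I f B \<subseteq> B \<longrightarrow> ?T B = {b}"
    then have "?T M = {b}" using assms by blast
    with a show "b = a" by simp
  qed
  with a show ?thesis by simp
qed

lemma code_point_eqI:
  assumes "\<omega> \<in> streams I" "M \<in> Pbcl" "fractal_op I f M \<subseteq> M"
    and "\<And>n. n \<ge> 1 \<Longrightarrow> a \<in> closure (word_map f (stake n \<omega>) ` M)"
  shows "code_point I f \<omega> = a"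
proof -
  have "a \<in> (\<Inter>n\<in>{1..}. closure (word_map f (stake n \<omega>) ` M))"
    using assms(4) by blast
  then show ?thesis unfolding code_point_props[OF assms(1-3)] by simp
qed

lemma code_point_in_closure:
  assumes "\<omega> \<in> streams I" "M \<in> Pbcl" "fractal_op I f M \<subseteq> M" "n \<ge> 1"
  shows "code_point I f \<omega> \<in> closure (word_map f (stake n \<omega>) ` M)"
proof -
  have "code_point I f \<omega> \<in> (\<Inter>n\<in>{1..}. closure (word_map f (stake n \<omega>) ` M))"
    unfolding code_point_props[OF assms(1-3)] by simp
  then show ?thesis by (rule INT_D) (use assms(4) in simp)
qed

lemma code_point_in_invariant:
  assumes "\<omega> \<in> streams I" "M \<in> Pbcl" "fractal_op I f M \<subseteq> M"
  shows "code_point I f \<omega> \<in> M"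
proof -
  have "closure (word_map f (stake 1 \<omega>) ` M) \<subseteq> M"
    using assms stake_in_words[OF assms(1), of 1]
    by (intro closure_minimal invariant_word_map) (auto simp: words_def Pbcl_def)
  then show ?thesis using code_point_in_closure[OF assms, of 1] by auto
qed

lemma invariant_exists:
  obtains M where "M \<in> Pbcl" "fractal_op I f M \<subseteq> M"
proof -
  have "{undefined} \<in> (Pbcl :: 'a set set)" by (simp add: Pbcl_def)
  then show thesis by (rule exists_invariant) (rule that)
qed

text \<open>A continuous map sends \<open>closure C\<close> into the closure of the image of \<open>C\<close>; applied to the
  prefix images of \<open>\<omega>\<close> this yields those of the word with the letter \<open>i\<close> in front.\<close>

lemma code_point_SCons:
  assumes "i \<in> I" "\<omega> \<in> streams I"
  shows "code_point I f (i ## \<omega>) = f i (code_point I f \<omega>)"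
proof -
  obtain M where M: "M \<in> Pbcl" "fractal_op I f M \<subseteq> M" by (rule invariant_exists)
  show ?thesis
  proof (rule code_point_eqI[OF _ M])
    fix n :: nat assume "n \<ge> 1"
    then obtain m where n: "n = Suc m" by (cases n) auto
    have "code_point I f \<omega> \<in> closure (word_map f (stake m \<omega>) ` M)"
    proof (cases m)
      case 0
      then show ?thesis
        using code_point_in_invariant[OF assms(2) M] closure_subset by auto
    next
      case (Suc k)
      then show ?thesis using code_point_in_closure[OF assms(2) M, of m] by linarith
    qed
    then have "f i (code_point I f \<omega>) \<in> closure (f i ` word_map f (stake m \<omega>) ` M)"
      using continuous_image_closure_subset[OF continuous_f[OF assms(1)]] by blast
    then show "f i (code_point I f \<omega>) \<in> closure (word_map f (stake n (i ## \<omega>)) ` M)"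
      by (simp add: n image_comp)
  qed (use assms in auto)
qed

section \<open>The set of code points as the attractor\<close>

abbreviation code_points :: "'a set" where
  "code_points \<equiv> code_point I f ` streams I"

lemma code_points_self_similar: "code_points = (\<Union>i\<in>I. f i ` code_points)"
proof
  show "(\<Union>i\<in>I. f i ` code_points) \<subseteq> code_points"
  proof (intro UN_least subsetI)
    fix i x assume i: "i \<in> I" and "x \<in> f i ` code_points"
    then obtain \<omega> where \<omega>: "\<omega> \<in> streams I" "x = f i (code_point I f \<omega>)" by blast
    then have "x = code_point I f (i ## \<omega>)" "i ## \<omega> \<in> streams I"
      using i by (simp_all add: code_point_SCons)
    then show "x \<in> code_points" by blast
  qed
  show "code_points \<subseteq> (\<Union>i\<in>I. f i ` code_points)"
  proof
    fix x assume "x \<in> code_points"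
    then obtain \<omega> where \<omega>: "\<omega> \<in> streams I" "x = code_point I f \<omega>" by blast
    then obtain i \<omega>' where "\<omega> = i ## \<omega>'" "i \<in> I" "\<omega>' \<in> streams I"
      by (metis streams.cases)
    with \<omega> code_point_SCons show "x \<in> (\<Union>i\<in>I. f i ` code_points)" by auto
  qed
qed

lemma code_points_UN_words: "(\<Union>w\<in>words I n. word_map f w ` code_points) = code_points"
proof (induction n)
  case 0
  show ?case by simp
next
  case (Suc n)
  have "(\<Union>w\<in>words I (Suc n). word_map f w ` code_points) = (\<Union>i\<in>I. f i ` code_points)"
    unfolding UN_words_Suc Suc.IH ..
  also have "\<dots> = code_points" by (rule code_points_self_similar[symmetric])
  finally show ?case .
qed

text \<open>Self-similarity lets the word of a limit point be found letter by letter. This is Koenig's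
  lemma; it takes the place of the compactness of the space of infinite words.\<close>

lemma closed_code_points: "closed code_points"
proof -
  have "x \<in> code_points" if x: "x \<in> closure code_points" for x
  proof -
    have "\<exists>i\<in>I. x \<in> closure (word_map f (w @ [i]) ` code_points)"
      if "x \<in> closure (word_map f w ` code_points)" for w
    proof -
      have "word_map f w ` code_points = (\<Union>i\<in>I. word_map f (w @ [i]) ` code_points)"
      proof -
        have "word_map f w ` code_points = word_map f w ` (\<Union>i\<in>I. f i ` code_points)"
          by (rule arg_cong[OF code_points_self_similar])
        then show ?thesis by (simp add: word_map_append image_UN image_comp)
      qed
      with that show ?thesis by (simp add: closure_finite_UN[OF finite_I])
    qed
    then obtain \<omega> where \<omega>: "\<omega> \<in> streams I"
      and in_cl: "\<And>n. x \<in> closure (word_map f (stake n \<omega>) ` code_points)"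
      using stream_of_extendable_prefixes[of "\<lambda>w. x \<in> closure (word_map f w ` code_points)" I] x
      by auto
    obtain M where M: "M \<in> Pbcl" "fractal_op I f M \<subseteq> M" by (rule invariant_exists)
    have "code_points \<subseteq> M" using code_point_in_invariant M by blast
    then have "x \<in> closure (word_map f (stake n \<omega>) ` M)" for n
      using in_cl closure_mono[OF image_mono] by blast
    then have "code_point I f \<omega> = x" by (intro code_point_eqI[OF \<omega> M])
    with \<omega> show ?thesis by blast
  qed
  then show ?thesis using closure_subset_eq by blast
qed

lemma code_points_Pbcl: "code_points \<in> Pbcl"
proof -
  obtain M where M: "M \<in> Pbcl" "fractal_op I f M \<subseteq> M" by (rule invariant_exists)
  have "code_points \<subseteq> M" using code_point_in_invariant M by blast
  then have "bounded code_points" using M(1) bounded_subset by (auto simp: Pbcl_def)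
  moreover obtain i where "i \<in> I" using I_nonempty by blast
  then have "sconst i \<in> streams I" by (simp add: streams_iff_snth)
  then have "code_points \<noteq> {}" by blast
  ultimately show ?thesis using closed_code_points by (simp add: Pbcl_def)
qed

lemma fractal_op_code_points: "fractal_op I f code_points = code_points"
  unfolding fractal_op_def code_points_self_similar[symmetric]
  using closed_code_points by (rule closure_closed)

text \<open>By continuity the closures taken at the intermediate stages can all be postponed to the
  last one.\<close>

lemma fractal_op_closure: "fractal_op I f (closure C) = closure (\<Union>i\<in>I. f i ` C)"
proof
  have "f i ` closure C \<subseteq> closure (\<Union>i\<in>I. f i ` C)" if "i \<in> I" for i
  proof -
    have "f i ` closure C \<subseteq> closure (f i ` C)"
      using continuous_image_closure_subset[OF continuous_f[OF that]] by simp
    also have "\<dots> \<subseteq> closure (\<Union>i\<in>I. f i ` C)" using that by (intro closure_mono) auto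
    finally show ?thesis .
  qed
  then show "fractal_op I f (closure C) \<subseteq> closure (\<Union>i\<in>I. f i ` C)"
    unfolding fractal_op_def by (intro closure_minimal) auto
  show "closure (\<Union>i\<in>I. f i ` C) \<subseteq> fractal_op I f (closure C)"
    unfolding fractal_op_def using closure_subset[of C] by (intro closure_mono) blast
qed

lemma fractal_op_funpow:
  assumes "closed B"
  shows "(fractal_op I f ^^ n) B = closure (\<Union>w\<in>words I n. word_map f w ` B)"
proof (induction n)
  case 0
  then show ?case using assms by (simp add: closure_closed)
next
  case (Suc n)
  then show ?case by (simp add: fractal_op_closure UN_words_Suc)
qed

lemma hausdorff_dist_funpow_tendsto_0:
  assumes B: "B \<in> Pbcl"
  shows "(\<lambda>n. hausdorff_dist ((fractal_op I f ^^ n) B) code_points) \<longlonglongrightarrow> 0"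
proof (rule LIMSEQ_I)
  fix e :: real assume "e > 0"
  obtain M where BM: "B \<union> code_points \<subseteq> M"
    and small: "\<And>e. e > 0 \<Longrightarrow> \<exists>N. \<forall>n\<ge>N. \<forall>w\<in>words I n. \<forall>x\<in>M. \<forall>y\<in>M.
        dist (word_map f w x) (word_map f w y) < e"
    using uniformly_small_word_images[OF Pbcl_Un[OF B code_points_Pbcl]] by metis
  \<comment> \<open>Half of \<open>e\<close>, because suprema only inherit the weak inequality.\<close>
  obtain N where N: "\<And>n w x y. n \<ge> N \<Longrightarrow> w \<in> words I n \<Longrightarrow> x \<in> M \<Longrightarrow> y \<in> M \<Longrightarrow>
      dist (word_map f w x) (word_map f w y) < e / 2"
    using small[OF half_gt_zero[OF \<open>e > 0\<close>]] by blast
  obtain b where b: "b \<in> B" using B by (auto simp: Pbcl_def)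
  obtain a where a: "a \<in> code_points" using code_points_Pbcl by (auto simp: Pbcl_def)
  have "\<bar>hausdorff_dist ((fractal_op I f ^^ n) B) code_points\<bar> \<le> e / 2" if n: "n \<ge> N" for n
  proof -
    let ?D = "\<Union>w\<in>words I n. word_map f w ` B"
    have iter: "(fractal_op I f ^^ n) B = closure ?D"
      using B by (intro fractal_op_funpow) (simp add: Pbcl_def)
    have near_A: "infdist x code_points \<le> e / 2" if "x \<in> ?D" for x
    proof -
      from that obtain w y where w: "w \<in> words I n" "y \<in> B" "x = word_map f w y" by blast
      then have "word_map f w a \<in> code_points"
        using a code_points_UN_words[of n] by blast
      moreover have "dist x (word_map f w a) \<le> e / 2"
        unfolding w(3) using w(2) a BM by (intro less_imp_le N[OF n w(1)]) auto
      ultimately show ?thesis by (rule infdist_le2)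
    qed
    have near_D: "infdist x (closure ?D) \<le> e / 2" if "x \<in> code_points" for x
    proof -
      from that obtain w y where w: "w \<in> words I n" "y \<in> code_points" "x = word_map f w y"
        using code_points_UN_words[of n] by blast
      then have "word_map f w b \<in> closure ?D"
        using b closure_subset[of ?D] by blast
      moreover have "dist x (word_map f w b) \<le> e / 2"
        unfolding w(3) using w(2) b BM by (intro less_imp_le N[OF n w(1)]) auto
      ultimately show ?thesis by (rule infdist_le2)
    qed
    show ?thesis unfolding iter
    proof (rule abs_hausdorff_dist_le)
      show "closure ?D \<noteq> {}" using b words_nonempty[OF I_nonempty] by auto
      show "code_points \<noteq> {}" using a by blast
      show "infdist x code_points \<le> e / 2" if "x \<in> closure ?D" for x
        using near_A that by (rule infdist_closure_le)
    qed (rule near_D)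
  qed
  then show "\<exists>N. \<forall>n\<ge>N. norm (hausdorff_dist ((fractal_op I f ^^ n) B) code_points - 0) < e"
    using \<open>e > 0\<close> by (intro exI[of _ N]) force
qed

lemma is_attractor_code_points: "is_attractor I f code_points"
  unfolding is_attractor_def
  using code_points_Pbcl fractal_op_code_points hausdorff_dist_funpow_tendsto_0 by blast

end

theorem proposition3p5:
  fixes I :: "'i set" and f :: "'i \<Rightarrow> 'a::complete_space \<Rightarrow> 'a"
  assumes "is_IFS I f"
    and "diam_diminishing I f"
  shows "has_attractor I f \<and>
    attractor I f = canonical_proj I f ` streams I \<and>
    canonical_proj I f ` streams I = {code_point I f \<omega> |\<omega>. \<omega> \<in> streams I}"
proof -
  have A: "is_attractor I f (code_point I f ` streams I)"
    by (rule is_attractor_code_points[OF assms])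
  then have "attractor I f = code_point I f ` streams I"
    unfolding attractor_def by (rule the_equality) (rule is_attractor_unique[OF _ A])
  with A show ?thesis
    by (auto simp: has_attractor_def canonical_proj_def)
qed

end
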